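(* Let $G$ be a connected graph. Then $G$ is chordal if and only if there exists $G_c\in\widetilde{H}(G)$ that is a tree. Moreover, if $G$ is chordal, then for every $G_c\in\widetilde{H}(G)$ and every leaf of $G_c$, the maximal clique of $G$ corresponding to that leaf has a vertex in its non-public part.
   Context: A graph is chordal if every cycle of length at least $4$ has a chord, i.e. an edge joining two nonadjacent vertices of the cycle. Clique graph: for a connected graph $G$, a clique graph $G_c$ has one vertex $v_C$ for each maximal clique $C$ of $G$. It is constructed as follows. - Start with $G'=\emptyset$ and $G_c=\emptyset$. - Repeatedly choose a maximal clique $C$ of $G$ not contained in $G'$. - If $V(C)\cap V(G')=\emptyset$, set $G'=G'\cup C$ and add the vertex $v_C$ to $G_c$. - Otherwise, let $S_1,\dots,S_k$ be the cliques of $G'$ at which $C$ meets $G'$, i.e. the maximal cliques of $G'[V(C)\cap V(G')]$. For each $i$ choose a maximal clique $C_i$ of $G$ with $S_i\subseteq C_i$, and let $v_{C_i}$ be its vertex in $G_c$. Set $G'=G'\cup C$, add $v_C$ to $G_c$, and add the edges $v_Cv_{C_i}$ for $1\le i\le k$. - Stop when $G'=G$ and output $G_c$. $\widetilde{H}(G)$ denotes the set of all clique graphs obtainable this way over all orders of clique selection and choices. A vertex $v$ of a maximal clique $C$ is in the public part of $C$ if $v$ belongs to some other maximal clique of $G$; otherwise it is in the non-public part of $C$. A leaf is a vertex of degree $1$. *)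

theory Defs
  imports "HOL-Library.Ramsey"
begin

text \<open>
  Graphs are finite, simple and undirected; an edge is a two-element set of vertices.
  The AFP digraph library is not used: it models graphs as symmetric digraphs, in which
  the closed walk \<open>a, b, a\<close> counts as a cycle, so its trees are not undirected trees.
\<close>

record 'a ugraph =
  verts :: "'a set"
  edges :: "'a set set"

definition simple_graph :: "'a ugraph \<Rightarrow> bool" where
  "simple_graph G \<longleftrightarrow> finite (verts G) \<and> edges G \<subseteq> [verts G]\<^bsup>2\<^esup>"

definition empty_graph :: "'a ugraph" where
  "empty_graph = \<lparr>verts = {}, edges = {}\<rparr>"

definition complete_graph :: "'a set \<Rightarrow> 'a ugraph" where
  "complete_graph K = \<lparr>verts = K, edges = [K]\<^bsup>2\<^esup>\<rparr>"

definition subgraph :: "'a ugraph \<Rightarrow> 'a ugraph \<Rightarrow> bool" where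
  "subgraph H G \<longleftrightarrow> verts H \<subseteq> verts G \<and> edges H \<subseteq> edges G"

definition graph_union :: "'a ugraph \<Rightarrow> 'a ugraph \<Rightarrow> 'a ugraph" where
  "graph_union G H = \<lparr>verts = verts G \<union> verts H, edges = edges G \<union> edges H\<rparr>"

definition induced_subgraph :: "'a ugraph \<Rightarrow> 'a set \<Rightarrow> 'a ugraph" where
  "induced_subgraph G W = \<lparr>verts = verts G \<inter> W, edges = {e \<in> edges G. e \<subseteq> W}\<rparr>"

definition connected_graph :: "'a ugraph \<Rightarrow> bool" where
  "connected_graph G \<longleftrightarrow> verts G \<noteq> {} \<and>
     (\<forall>u \<in> verts G. \<forall>v \<in> verts G. (u, v) \<in> {(x, y). {x, y} \<in> edges G}\<^sup>*)"

text \<open>A cycle is given by the list of its vertices in cyclic order, without repeating the first.\<close>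

definition cycle_edges :: "'a list \<Rightarrow> 'a set set" where
  "cycle_edges c = {{c ! i, c ! (Suc i mod length c)} | i. i < length c}"

definition is_cycle :: "'a ugraph \<Rightarrow> 'a list \<Rightarrow> bool" where
  "is_cycle G c \<longleftrightarrow> 3 \<le> length c \<and> distinct c \<and> set c \<subseteq> verts G \<and> cycle_edges c \<subseteq> edges G"

definition has_chord :: "'a ugraph \<Rightarrow> 'a list \<Rightarrow> bool" where
  "has_chord G c \<longleftrightarrow> (\<exists>u \<in> set c. \<exists>v \<in> set c. {u, v} \<in> edges G \<and> {u, v} \<notin> cycle_edges c)"

definition chordal :: "'a ugraph \<Rightarrow> bool" where
  "chordal G \<longleftrightarrow> (\<forall>c. is_cycle G c \<and> 4 \<le> length c \<longrightarrow> has_chord G c)"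

definition is_tree :: "'a ugraph \<Rightarrow> bool" where
  "is_tree G \<longleftrightarrow> connected_graph G \<and> (\<nexists>c. is_cycle G c)"

definition degree :: "'a ugraph \<Rightarrow> 'a \<Rightarrow> nat" where
  "degree G v = card {e \<in> edges G. v \<in> e}"

definition is_leaf :: "'a ugraph \<Rightarrow> 'a \<Rightarrow> bool" where
  "is_leaf G v \<longleftrightarrow> v \<in> verts G \<and> degree G v = 1"

definition max_clique :: "'a ugraph \<Rightarrow> 'a set \<Rightarrow> bool" where
  "max_clique G K \<longleftrightarrow> K \<subseteq> verts G \<and> clique K (edges G) \<and>
     (\<forall>L. K \<subseteq> L \<and> L \<subseteq> verts G \<and> clique L (edges G) \<longrightarrow> L = K)"

text \<open>The maximal cliques \<open>S\<^sub>1, \<dots>, S\<^sub>k\<close> of \<open>H[V(C) \<inter> V(H)]\<close>.\<close>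

definition meeting_cliques :: "'a ugraph \<Rightarrow> 'a set \<Rightarrow> 'a set set" where
  "meeting_cliques H C = {S. max_clique (induced_subgraph H (C \<inter> verts H)) S}"

text \<open>
  \<open>clique_graph_run G H T\<close>: the construction on \<open>G\<close> can reach a state with current
  subgraph \<open>H\<close> (that is, \<open>G'\<close>) and current clique graph \<open>T\<close>.  The vertex \<open>v\<^sub>C\<close> of
  \<open>T\<close> is the vertex set \<open>C\<close> itself.  The function \<open>f\<close> in the last rule is the choice
  \<open>S\<^sub>i \<mapsto> C\<^sub>i\<close>; since the edge \<open>v\<^sub>C v\<^bsub>C\<^sub>i\<^esub>\<close> is drawn at that step, \<open>C\<^sub>i\<close> must already
  have a vertex in \<open>T\<close>.
\<close>

inductive clique_graph_run :: "'a ugraph \<Rightarrow> 'a ugraph \<Rightarrow> 'a set ugraph \<Rightarrow> bool"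
  for G :: "'a ugraph" where
  start: "clique_graph_run G empty_graph empty_graph"
| disjoint:
    "\<lbrakk>clique_graph_run G H T;
      max_clique G C; \<not> subgraph (complete_graph C) H;
      C \<inter> verts H = {}\<rbrakk>
     \<Longrightarrow> clique_graph_run G (graph_union H (complete_graph C))
           \<lparr>verts = insert C (verts T), edges = edges T\<rparr>"
| meeting:
    "\<lbrakk>clique_graph_run G H T;
      max_clique G C; \<not> subgraph (complete_graph C) H;
      C \<inter> verts H \<noteq> {};
      \<And>S. S \<in> meeting_cliques H C \<Longrightarrow> max_clique G (f S) \<and> S \<subseteq> f S \<and> f S \<in> verts T\<rbrakk>
     \<Longrightarrow> clique_graph_run G (graph_union H (complete_graph C))
           \<lparr>verts = insert C (verts T),
            edges = edges T \<union> {{C, f S} | S. S \<in> meeting_cliques H C}\<rparr>"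

definition clique_graphs :: "'a ugraph \<Rightarrow> 'a set ugraph set" where
  "clique_graphs G = {T. clique_graph_run G G T}"

definition public_part :: "'a ugraph \<Rightarrow> 'a set \<Rightarrow> 'a set" where
  "public_part G C = {v \<in> C. \<exists>D. max_clique G D \<and> D \<noteq> C \<and> v \<in> D}"

definition non_public_part :: "'a ugraph \<Rightarrow> 'a set \<Rightarrow> 'a set" where
  "non_public_part G C = C - public_part G C"

end

theory Submission
  imports Defs
begin

text \<open>
  Throughout the construction, the nodes of the clique graph that contain a given vertex of
  \<open>G\<close> induce a connected subgraph, because a clique \<open>C\<close> entering with an old vertex \<open>v\<close> is joined
  to some \<open>C\<^sub>i\<close> containing \<open>v\<close>.

  A leaf \<open>C\<close> with neighbour \<open>D\<close> must therefore have a non-public vertex: otherwise each of its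
  vertices also lies in \<open>D\<close>, and \<open>C \<subseteq> D\<close> contradicts maximality.

  If the clique graph is acyclic, a clique entering at \<open>S\<^sub>1, \<dots>, S\<^sub>k\<close> is glued to distinct
  components of \<open>G'\<close>, since two \<open>C\<^sub>i\<close> in one component of the clique graph would close a cycle.
  A long cycle through a new edge \<open>x y\<close> then either has a third vertex in \<open>C\<close>, which gives a
  chord, or connects \<open>x\<close> and \<open>y\<close> inside \<open>G'\<close>. So \<open>G'\<close> stays chordal.

  Conversely, by Dirac's theorem a chordal graph has a simplicial vertex. Removing such vertices
  one by one yields an ordering of the maximal cliques with the running intersection property,
  and along this ordering each new clique is attached by at most one edge.
\<close>

section \<open>Graph basics\<close>

lemma simple_graph_edgeD:
  assumes "simple_graph G" "{x, y} \<in> edges G"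
  shows "x \<in> verts G" "y \<in> verts G" "x \<noteq> y"
proof -
  have "{x, y} \<in> [verts G]\<^bsup>2\<^esup>" using assms unfolding simple_graph_def by blast
  then show "x \<in> verts G" "y \<in> verts G" "x \<noteq> y" by simp_all
qed

lemma simple_graph_induced: "simple_graph G \<Longrightarrow> simple_graph (induced_subgraph G W)"
  by (auto simp: simple_graph_def induced_subgraph_def nsets_def)

text \<open>Both ends of a chord lie on the cycle, hence in \<open>W\<close>, so the chord survives
  the restriction.\<close>

lemma chordal_induced:
  assumes "chordal G"
  shows "chordal (induced_subgraph G W)"
  unfolding chordal_def
proof (intro allI impI)
  fix c assume c: "is_cycle (induced_subgraph G W) c \<and> 4 \<le> length c"
  then have "is_cycle G c" "set c \<subseteq> W"
    by (auto simp: is_cycle_def induced_subgraph_def)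
  with c assms have "has_chord G c" by (auto simp: chordal_def)
  with \<open>set c \<subseteq> W\<close> show "has_chord (induced_subgraph G W) c"
    by (fastforce simp: has_chord_def induced_subgraph_def)
qed

lemma clique_extends_to_max_clique:
  assumes "finite (verts G)" "K \<subseteq> verts G" "clique K (edges G)"
  obtains M where "max_clique G M" "K \<subseteq> M"
proof -
  let ?F = "{L. K \<subseteq> L \<and> L \<subseteq> verts G \<and> clique L (edges G)}"
  have "finite ?F" using assms(1) by (auto intro: finite_subset[of _ "Pow (verts G)"])
  moreover have "?F \<noteq> {}" using assms by blast
  ultimately obtain M where M: "M \<in> ?F" "\<forall>L\<in>?F. M \<subseteq> L \<longrightarrow> M = L"
    using finite_has_maximal[of ?F] by auto
  then have "max_clique G M" by (auto simp: max_clique_def)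
  with M that show thesis by blast
qed

lemma max_cliqueD:
  assumes "max_clique G K"
  shows "K \<subseteq> verts G" "clique K (edges G)"
    "\<And>L. K \<subseteq> L \<Longrightarrow> L \<subseteq> verts G \<Longrightarrow> clique L (edges G) \<Longrightarrow> L = K"
  using assms unfolding max_clique_def by blast+

lemma max_clique_subset_eq: "max_clique G C \<Longrightarrow> max_clique G D \<Longrightarrow> C \<subseteq> D \<Longrightarrow> C = D"
  by (auto simp: max_clique_def)

text \<open>The empty clique extends to a singleton as soon as there is a vertex.\<close>

lemma max_clique_nonempty:
  assumes "verts G \<noteq> {}" "max_clique G C"
  shows "C \<noteq> {}"
proof
  assume "C = {}"
  obtain x where "x \<in> verts G" using assms by blast
  with assms(2) \<open>C = {}\<close> have "{x} = C"
    by (auto simp: max_clique_def clique_def)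
  with \<open>C = {}\<close> show False by simp
qed

section \<open>Walks and cycles\<close>

text \<open>A walk of least length inside \<open>A\<close> works: a repeated vertex or an edge
  between non-consecutive positions would allow a shortcut. The result is an induced path.\<close>

lemma obtain_shortest_walk:
  assumes "(s, t) \<in> {(x, y). {x, y} \<in> E \<and> x \<in> A \<and> y \<in> A}\<^sup>*" "s \<in> A"
  obtains xs where "xs \<noteq> []" "hd xs = s" "last xs = t" "distinct xs" "set xs \<subseteq> A"
    "\<And>i. Suc i < length xs \<Longrightarrow> {xs ! i, xs ! Suc i} \<in> E"
    "\<And>i j. i < j \<Longrightarrow> j < length xs \<Longrightarrow> {xs ! i, xs ! j} \<in> E \<Longrightarrow> j = Suc i"
proof -
  define adj where "adj x y \<longleftrightarrow> {x, y} \<in> E" for x y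
  define Q where "Q xs \<longleftrightarrow> xs \<noteq> [] \<and> hd xs = s \<and> last xs = t \<and> set xs \<subseteq> A \<and> successively adj xs"
    for xs
  have "\<exists>xs. xs \<noteq> [] \<and> hd xs = s \<and> last xs = t \<and> set xs \<subseteq> A \<and> successively adj xs"
    using assms(1)
  proof (induction rule: rtrancl_induct)
    case base
    then show ?case using assms(2) by (intro exI[of _ "[s]"]) simp
  next
    case (step y z)
    then obtain xs where "xs \<noteq> []" "hd xs = s" "last xs = y" "set xs \<subseteq> A" "successively adj xs"
      by blast
    with step(2) show ?case
      by (intro exI[of _ "xs @ [z]"]) (simp add: adj_def successively_append_iff)
  qed
  then have "\<exists>xs. Q xs" by (simp add: Q_def)
  then obtain xs where Q: "Q xs" and least: "\<And>ys. Q ys \<Longrightarrow> length xs \<le> length ys"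
    using ex_has_least_nat[of Q _ length] by blast
  \<comment> \<open>Removing the positions strictly between \<open>i\<close> and \<open>j\<close>
    keeps both ends and shortens the list, so by minimality the remainder cannot be a walk.\<close>
  have cut: "\<not> (successively adj (take (Suc i) xs @ drop j xs))"
    if "i < j" "j < length xs" "j \<noteq> Suc i" for i j
  proof
    assume *: "successively adj (take (Suc i) xs @ drop j xs)"
    have "Q (take (Suc i) xs @ drop j xs)"
      using Q that * set_take_subset[of "Suc i" xs] set_drop_subset[of j xs]
      by (auto simp: Q_def hd_append)
    from least[OF this] that show False by simp
  qed
  have short: "j = Suc i" if "i < j" "j < length xs" "adj (xs ! i) (xs ! j)" for i j
  proof (rule ccontr)
    assume "j \<noteq> Suc i"
    moreover have "successively adj (take (Suc i) xs)" "successively adj (drop j xs)"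
      using Q append_take_drop_id[of "Suc i" xs] append_take_drop_id[of j xs]
        successively_append_iff[of adj] unfolding Q_def by metis+
    moreover have "last (take (Suc i) xs) = xs ! i" "hd (drop j xs) = xs ! j"
      using that by (simp_all add: take_Suc_conv_app_nth hd_drop_conv_nth)
    ultimately have "successively adj (take (Suc i) xs @ drop j xs)"
      using that by (auto simp: successively_append_iff)
    with cut that \<open>j \<noteq> Suc i\<close> show False by blast
  qed
  have "distinct xs"
  proof (rule ccontr)
    assume "\<not> distinct xs"
    then obtain i j where ij: "i < j" "j < length xs" "xs ! i = xs ! j"
      by (metis distinct_conv_nth linorder_neqE_nat)
    \<comment> \<open>Positions \<open>i + 1\<close> to \<open>j\<close> are removed; the edge
      leaving \<open>xs ! j\<close> also leaves \<open>xs ! i\<close>. If \<open>j\<close> is the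
      last position, the prefix already ends in \<open>t\<close>.\<close>
    have "Q (take (Suc i) xs @ drop (Suc j) xs)"
    proof (cases "Suc j < length xs")
      case True
      have "successively adj (take (Suc i) xs)" "successively adj (drop (Suc j) xs)"
        using Q append_take_drop_id[of "Suc i" xs] append_take_drop_id[of "Suc j" xs]
          successively_append_iff[of adj] unfolding Q_def by metis+
      moreover have "last (take (Suc i) xs) = xs ! i" "hd (drop (Suc j) xs) = xs ! Suc j"
        using ij True by (simp_all add: take_Suc_conv_app_nth hd_drop_conv_nth)
      moreover have "adj (xs ! j) (xs ! Suc j)"
        using Q True by (auto simp: Q_def successively_conv_nth)
      ultimately have "successively adj (take (Suc i) xs @ drop (Suc j) xs)"
        using ij by (auto simp: successively_append_iff)
      then show ?thesis
        using Q ij True set_take_subset[of "Suc i" xs] set_drop_subset[of "Suc j" xs]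
        by (auto simp: Q_def hd_append)
    next
      case False
      with ij have j: "Suc j = length xs" by simp
      have "xs ! j = t"
        using Q j last_conv_nth[of xs] unfolding Q_def by (metis diff_Suc_1)
      with ij have "last (take (Suc i) xs) = t" by (simp add: take_Suc_conv_app_nth)
      moreover have "successively adj (take (Suc i) xs)"
        using Q append_take_drop_id[of "Suc i" xs] successively_append_iff[of adj]
        unfolding Q_def by metis
      ultimately show ?thesis
        using Q ij j set_take_subset[of "Suc i" xs]
        by (auto simp: Q_def)
    qed
    from least[OF this] ij show False by simp
  qed
  with Q short show thesis
    by (intro that[of xs]) (auto simp: Q_def adj_def successively_conv_nth)
qed

section \<open>Edges and rotations of a cycle\<close>

text \<open>Distinct vertices determine their positions, so being an edge of the cycle becomes
  arithmetic modulo its length.\<close>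

lemma nth_doubleton_in_cycle_edges_iff:
  assumes "distinct c" "i < length c" "j < length c"
  shows "{c ! i, c ! j} \<in> cycle_edges c \<longleftrightarrow> j = Suc i mod length c \<or> i = Suc j mod length c"
proof -
  have m: "Suc k mod length c < length c" for k using assms by (intro mod_less_divisor) auto
  show ?thesis
    using assms m by (auto simp: cycle_edges_def doubleton_eq_iff nth_eq_iff_index_eq)
qed

text \<open>Rotation shifts positions by \<open>m\<close> modulo the length, and successive
  positions stay successive. One inclusion for all \<open>m\<close> suffices, since a further
  rotation undoes the first.\<close>

lemma cycle_edges_rotate: "cycle_edges (rotate m c) = cycle_edges c"
proof -
  let ?n = "length c"
  have sub: "cycle_edges (rotate m c) \<subseteq> cycle_edges c" for m and c :: "'b list"
  proof
    fix e assume "e \<in> cycle_edges (rotate m c)"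
    then obtain i where i: "i < length c"
      "e = {rotate m c ! i, rotate m c ! (Suc i mod length c)}"
      by (auto simp: cycle_edges_def)
    moreover have "Suc i mod length c < length c" using i by (intro mod_less_divisor) auto
    ultimately have "e = {c ! ((m + i) mod length c), c ! ((m + Suc i mod length c) mod length c)}"
      by (simp add: nth_rotate)
    also have "(m + Suc i mod length c) mod length c = Suc ((m + i) mod length c) mod length c"
      by (simp add: mod_simps)
    finally have "e = {c ! ((m + i) mod length c), c ! (Suc ((m + i) mod length c) mod length c)}" .
    moreover have "(m + i) mod length c < length c" using i(1) by (intro mod_less_divisor) auto
    ultimately show "e \<in> cycle_edges c" unfolding cycle_edges_def by blast
  qed
  \<comment> \<open>Reducing \<open>m\<close> modulo the length first keeps the subtraction of
    naturals from truncating.\<close>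
  have "c = rotate (?n - m mod ?n) (rotate m c)"
  proof (cases "c = []")
    case False
    then have "?n - m mod ?n + m mod ?n = ?n" by (simp add: less_imp_le)
    then have "(?n - m mod ?n + m) mod ?n = 0" by (metis mod_add_right_eq mod_self)
    then show ?thesis by (metis rotate_rotate rotate_id)
  qed simp
  then have "cycle_edges c \<subseteq> cycle_edges (rotate m c)" using sub by metis
  with sub show ?thesis by blast
qed

lemma is_cycle_rotate: "is_cycle G (rotate m c) \<longleftrightarrow> is_cycle G c"
  by (simp add: is_cycle_def cycle_edges_rotate)

lemma has_chord_rotate: "has_chord G (rotate m c) \<longleftrightarrow> has_chord G c"
  by (simp add: has_chord_def cycle_edges_rotate)

text \<open>Once \<open>v\<close> is rotated to position 0, its neighbours sit at position 1 and at
  the last position; these differ because the length is at least 3.\<close>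

lemma cycle_has_two_neighbours:
  assumes "is_cycle G c" "v \<in> set c"
  obtains a b where "a \<noteq> b" "{v, a} \<in> edges G" "{v, b} \<in> edges G"
proof -
  obtain k where k: "k < length c" "v = c ! k" using assms(2) by (auto simp: in_set_conv_nth)
  let ?c = "rotate k c" and ?n = "length c"
  have n: "3 \<le> ?n" and d: "distinct ?c" and E: "cycle_edges ?c \<subseteq> edges G"
    using assms(1) by (auto simp: is_cycle_def cycle_edges_rotate)
  obtain r where r: "?n = Suc (Suc (Suc r))"
    using n by (metis Suc_le_D Suc_le_mono numeral_3_eq_3)
  then have n0: "c \<noteq> []" by auto
  have v: "?c ! 0 = v" using k n0 nth_rotate[of 0 c k] by simp
  have "?c ! 1 \<noteq> ?c ! (?n - 1)"
    using n d by (subst nth_eq_iff_index_eq) auto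
  moreover have "{?c ! 0, ?c ! 1} \<in> cycle_edges ?c"
    by (subst nth_doubleton_in_cycle_edges_iff[OF d]) (simp_all add: r n0)
  moreover have "{?c ! 0, ?c ! (?n - 1)} \<in> cycle_edges ?c"
    by (subst nth_doubleton_in_cycle_edges_iff[OF d]) (simp_all add: r n0)
  ultimately show thesis using that E v by auto
qed

lemma cycle_avoiding_vertexI:
  assumes "is_cycle G c" "\<And>a b. {v, a} \<in> edges G \<Longrightarrow> {v, b} \<in> edges G \<Longrightarrow> a = b"
  shows "v \<notin> set c"
  using cycle_has_two_neighbours assms by metis

section \<open>Cycles avoided or created by a new vertex\<close>

text \<open>A cycle through \<open>C\<close> would need two different neighbours of
  \<open>C\<close>, but the new edges offer only \<open>D\<close>; a cycle avoiding \<open>C\<close>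
  lies in \<open>T\<close>. An empty \<open>F\<close> covers a clique disjoint from the current
  subgraph.\<close>

lemma acyclic_add_pendant:
  assumes "\<nexists>c. is_cycle T c" "edges T \<subseteq> [verts T]\<^bsup>2\<^esup>" "C \<notin> verts T"
    and F: "F \<subseteq> {{C, D}}"
  shows "\<nexists>c. is_cycle \<lparr>verts = insert C (verts T), edges = edges T \<union> F\<rparr> c"
proof
  let ?T = "\<lparr>verts = insert C (verts T), edges = edges T \<union> F\<rparr>"
  assume "\<exists>c. is_cycle ?T c"
  then obtain c where c: "is_cycle ?T c" by blast
  have nC: "C \<notin> e" if "e \<in> edges T" for e using that assms(2,3) by (auto simp: nsets_def)
  have "C \<notin> set c"
  proof (rule cycle_avoiding_vertexI[OF c])
    fix a b assume "{C, a} \<in> edges ?T" "{C, b} \<in> edges ?T"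
    then have "{C, a} \<in> F" "{C, b} \<in> F" using nC by auto
    with F have "{C, a} = {C, D}" "{C, b} = {C, D}" by auto
    then show "a = b" by (metis doubleton_eq_iff)
  qed
  moreover have "e \<subseteq> set c" if "e \<in> cycle_edges c" for e
  proof -
    from that have "c \<noteq> []" by (auto simp: cycle_edges_def)
    with that show ?thesis by (auto simp: cycle_edges_def)
  qed
  ultimately have "C \<notin> e" if "e \<in> cycle_edges c" for e using that by blast
  moreover have "cycle_edges c \<subseteq> edges T \<union> F" using c by (simp add: is_cycle_def)
  ultimately have "cycle_edges c \<subseteq> edges T" using F by blast
  with c \<open>C \<notin> set c\<close> have "is_cycle T c" by (auto simp: is_cycle_def)
  with assms(1) show False by blast
qed

text \<open>A shortest path from \<open>A\<close> to \<open>B\<close> in \<open>T\<close> avoids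
  \<open>C\<close> and has at least two vertices; the two edges at \<open>C\<close> close
  it.\<close>

lemma cycle_through_new_vertex:
  assumes "(A, B) \<in> {(X, Y). {X, Y} \<in> edges T}\<^sup>*" "A \<noteq> B"
    and T: "edges T \<subseteq> [verts T]\<^bsup>2\<^esup>" "A \<in> verts T" "C \<notin> verts T"
    and T': "verts T \<subseteq> verts T'" "C \<in> verts T'" "edges T \<subseteq> edges T'"
      "{C, A} \<in> edges T'" "{C, B} \<in> edges T'"
  shows "\<exists>c. is_cycle T' c"
proof -
  \<comment> \<open>Edges lie inside \<open>verts T\<close>, so the walk can be confined to that
    set, which keeps \<open>C\<close> off the path.\<close>
  have "{(X, Y). {X, Y} \<in> edges T} = {(X, Y). {X, Y} \<in> edges T \<and> X \<in> verts T \<and> Y \<in> verts T}"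
    using subsetD[OF T(1)] by fastforce
  with assms(1) have "(A, B) \<in> {(X, Y). {X, Y} \<in> edges T \<and> X \<in> verts T \<and> Y \<in> verts T}\<^sup>*" by simp
  from obtain_shortest_walk[OF this T(2)] obtain xs where
    xs: "xs \<noteq> []" "hd xs = A" "last xs = B" "distinct xs" "set xs \<subseteq> verts T"
    "\<And>i. Suc i < length xs \<Longrightarrow> {xs ! i, xs ! Suc i} \<in> edges T"
    by blast
  have len: "2 \<le> length xs" using xs \<open>A \<noteq> B\<close> by (cases xs) (auto simp: Suc_le_eq)
  have "cycle_edges (C # xs) \<subseteq> edges T'"
  proof
    fix e assume "e \<in> cycle_edges (C # xs)"
    then obtain i where i: "i < Suc (length xs)"
      "e = {(C # xs) ! i, (C # xs) ! (Suc i mod Suc (length xs))}"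
      by (auto simp: cycle_edges_def)
    \<comment> \<open>The edge from \<open>C\<close> to \<open>A\<close>, the closing edge from
      \<open>B\<close> back to \<open>C\<close>, and the edges of the path.\<close>
    consider "i = 0" | "i = length xs" "i \<noteq> 0" | k where "i = Suc k" "Suc k < length xs"
      using i(1) xs(1) by (cases i) (auto simp: less_Suc_eq)
    then show "e \<in> edges T'"
    proof cases
      case 1
      then show ?thesis using i xs T' len by (auto simp: hd_conv_nth)
    next
      case 2
      then have "(C # xs) ! i = B" using xs by (simp add: last_conv_nth)
      then show ?thesis using i 2 T' by (auto simp: insert_commute)
    next
      case 3
      then show ?thesis using i xs(6)[of k] T' by auto
    qed
  qed
  then have "is_cycle T' (C # xs)"
    using xs len T T' by (auto simp: is_cycle_def)
  then show ?thesis by blast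
qed

section \<open>Simplicial vertices of chordal graphs\<close>

definition simplicial :: "'a ugraph \<Rightarrow> 'a \<Rightarrow> bool" where
  "simplicial G v \<longleftrightarrow> clique {w. {v, w} \<in> edges G} (edges G)"

text \<open>If \<open>s\<close> and \<open>t\<close> were not adjacent, a shortest path between them
  through \<open>M\<close> would have at least three vertices and form with \<open>u\<close> a cycle
  of length at least 4. It has no chord: the path is induced, and on it \<open>u\<close> is adjacent
  only to the two ends.\<close>

lemma chordal_common_neighbours_adjacent:
  assumes G: "simple_graph G" "chordal G"
    and st: "s \<noteq> t" "{u, s} \<in> edges G" "{u, t} \<in> edges G"
    and M: "u \<notin> M" "M \<subseteq> verts G" "\<And>m. m \<in> M \<Longrightarrow> {u, m} \<notin> edges G"
    and walk: "(s, t) \<in> {(x, y). {x, y} \<in> edges G \<and> x \<in> insert s (insert t M)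
                        \<and> y \<in> insert s (insert t M)}\<^sup>*"
  shows "{s, t} \<in> edges G"
proof (rule ccontr)
  assume nadj: "{s, t} \<notin> edges G"
  from obtain_shortest_walk[OF walk] obtain xs where
    xs: "xs \<noteq> []" "hd xs = s" "last xs = t" "distinct xs" "set xs \<subseteq> insert s (insert t M)"
    and E: "\<And>i. Suc i < length xs \<Longrightarrow> {xs ! i, xs ! Suc i} \<in> edges G"
    and short: "\<And>i j. i < j \<Longrightarrow> j < length xs \<Longrightarrow> {xs ! i, xs ! j} \<in> edges G \<Longrightarrow> j = Suc i"
    by blast
  let ?c = "u # xs" and ?n = "Suc (length xs)"
  have s0: "xs ! 0 = s" and t0: "xs ! (length xs - 1) = t"
    using xs by (simp_all add: hd_conv_nth last_conv_nth)
  have "length xs \<noteq> 1" using s0 t0 st by auto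
  moreover have "length xs \<noteq> 2"
  proof
    assume "length xs = 2"
    with E[of 0] s0 t0 nadj show False by simp
  qed
  ultimately have len: "3 \<le> length xs" using xs(1) by (cases "length xs") auto
  have u: "u \<notin> set xs" using xs(5) M(1) simple_graph_edgeD[OF G(1)] st by blast
  then have dist: "distinct ?c" using xs(4) by simp
  have "cycle_edges ?c \<subseteq> edges G"
  proof
    fix e assume "e \<in> cycle_edges ?c"
    then obtain i where i: "i < ?n" "e = {?c ! i, ?c ! (Suc i mod ?n)}"
      by (auto simp: cycle_edges_def)
    consider "i = 0" | "i = length xs" "i \<noteq> 0" | k where "i = Suc k" "Suc k < length xs"
      using i(1) xs(1) by (cases i) (auto simp: less_Suc_eq)
    then show "e \<in> edges G"
    proof cases
      case 1
      then show ?thesis using i st xs(1) s0 by simp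
    next
      case 2
      then have "?c ! i = t" using t0 by simp
      then show ?thesis using i 2 st by (simp add: insert_commute)
    next
      case 3
      then show ?thesis using i E[of k] by simp
    qed
  qed
  moreover have "set ?c \<subseteq> verts G"
    using xs(5) M(2) simple_graph_edgeD[OF G(1)] st by auto
  ultimately have "is_cycle G ?c" using dist len by (simp add: is_cycle_def)
  with G(2) len have "has_chord G ?c" by (simp add: chordal_def)
  then obtain a b where ab: "a \<in> set ?c" "b \<in> set ?c" "{a, b} \<in> edges G" "{a, b} \<notin> cycle_edges ?c"
    unfolding has_chord_def by blast
  have no_chord: "{?c ! i, ?c ! j} \<in> cycle_edges ?c"
    if ij: "i < j" "j < ?n" "{?c ! i, ?c ! j} \<in> edges G" for i j
  proof (cases i)
    case 0
    then obtain k where k: "j = Suc k" "k < length xs" using ij by (cases j) auto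
    then have "xs ! k \<in> set xs" "{u, xs ! k} \<in> edges G" using ij 0 by auto
    \<comment> \<open>\<open>u\<close> has no neighbour in \<open>M\<close>, so an edge from
      \<open>u\<close> to the path ends in \<open>s\<close> or \<open>t\<close>, the cyclic
      neighbours of \<open>u\<close>.\<close>
    then have "xs ! k = xs ! 0 \<or> xs ! k = xs ! (length xs - 1)" using M xs(5) s0 t0 by auto
    then have "k = 0 \<or> k = length xs - 1"
      using k len nth_eq_iff_index_eq[OF xs(4), of k 0]
        nth_eq_iff_index_eq[OF xs(4), of k "length xs - 1"] by linarith
    then have "j = Suc i mod ?n \<or> i = Suc j mod ?n" using k 0 len by auto
    then show ?thesis
      using nth_doubleton_in_cycle_edges_iff[OF dist, of i j] ij by simp
  next
    case (Suc i')
    then obtain j' where j': "j = Suc j'" "j' < length xs" using ij by (cases j) auto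
    then have "j' = Suc i'" using short[of i' j'] ij Suc by simp
    then have "j = Suc i mod ?n" using Suc j' by simp
    then show ?thesis
      using nth_doubleton_in_cycle_edges_iff[OF dist, of i j] ij by simp
  qed
  obtain i j where ij: "i < ?n" "j < ?n" "a = ?c ! i" "b = ?c ! j"
    using ab(1,2) unfolding in_set_conv_nth by auto
  have "i \<noteq> j" using ab(3) simple_graph_edgeD(3)[OF G(1), of a b] ij by auto
  then consider "i < j" | "j < i" by linarith
  then show False
  proof cases
    case 1
    then show False using no_chord[of i j] ab ij by simp
  next
    case 2
    then show False using no_chord[of j i] ab ij by (simp add: insert_commute)
  qed
qed

text \<open>A strengthened form of Dirac's theorem: prescribing a vertex that the simplicial vertex
  must not be adjacent to lets the induction hypothesis steer away from the clique \<open>S\<close>.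
  The induction passes to \<open>B\<close> together with its boundary \<open>S\<close>, which misses
  \<open>u\<close>.\<close>

lemma chordal_simplicial_nonneighbour:
  assumes "simple_graph G" "chordal G" "u \<in> verts G" "w \<in> verts G" "w \<noteq> u" "{u, w} \<notin> edges G"
  shows "\<exists>v \<in> verts G. v \<noteq> u \<and> {u, v} \<notin> edges G \<and> simplicial G v"
  using assms
proof (induction "card (verts G)" arbitrary: G u w rule: less_induct)
  case less
  note G = less.prems(1,2)
  note edgeD = simple_graph_edgeD[OF G(1)]
  \<comment> \<open>\<open>M\<close> holds the non-neighbours of \<open>u\<close>, \<open>B\<close>
    is the component of \<open>w\<close> in \<open>M\<close>, and \<open>S\<close> is the set of
    neighbours of \<open>B\<close> outside \<open>B\<close>; they turn out to be neighbours of
    \<open>u\<close>.\<close>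
  define M where "M = {x \<in> verts G. x \<noteq> u \<and> {u, x} \<notin> edges G}"
  define R where "R = {(x, y). {x, y} \<in> edges G \<and> x \<in> M \<and> y \<in> M}"
  define B where "B = {b. (w, b) \<in> R\<^sup>*}"
  define S where "S = {s. s \<notin> B \<and> (\<exists>b \<in> B. {b, s} \<in> edges G)}"
  have wM: "w \<in> M" using less.prems by (simp add: M_def)
  have BM: "B \<subseteq> M"
  proof
    fix b assume "b \<in> B"
    then have "(w, b) \<in> R\<^sup>*" by (simp add: B_def)
    then show "b \<in> M" using wM by (induction rule: rtrancl_induct) (auto simp: R_def)
  qed
  have wB: "w \<in> B" by (simp add: B_def)
  have symR: "sym R" by (auto simp: R_def sym_def insert_commute)
  have SN: "{u, s} \<in> edges G" if s: "s \<in> S" for s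
  proof (rule ccontr)
    assume n: "{u, s} \<notin> edges G"
    obtain b where b: "b \<in> B" "{b, s} \<in> edges G" using s by (auto simp: S_def)
    with BM have "b \<in> M" by blast
    then have "s \<noteq> u" using b by (auto simp: M_def insert_commute)
    then have "s \<in> M" using n edgeD[OF b(2)] by (simp add: M_def)
    then have "(b, s) \<in> R" using b \<open>b \<in> M\<close> by (simp add: R_def)
    with b(1) have "s \<in> B" by (auto simp: B_def)
    with s show False by (simp add: S_def)
  qed
  \<comment> \<open>\<open>s\<close> and \<open>t\<close> are common neighbours of \<open>u\<close>
    joined by a walk through \<open>B\<close>, hence with its interior in \<open>M\<close>.\<close>
  have Sclique: "{s, t} \<in> edges G" if st: "s \<in> S" "t \<in> S" "s \<noteq> t" for s t
  proof -
    obtain b b' where b: "b \<in> B" "{b, s} \<in> edges G" and b': "b' \<in> B" "{b', t} \<in> edges G"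
      using st by (auto simp: S_def)
    let ?A = "insert s (insert t M)"
    let ?R = "{(x, y). {x, y} \<in> edges G \<and> x \<in> ?A \<and> y \<in> ?A}"
    have "(b, w) \<in> R\<^sup>*" using b(1) symR by (auto simp: B_def dest: sym_rtrancl symD)
    moreover have "(w, b') \<in> R\<^sup>*" using b'(1) by (simp add: B_def)
    ultimately have "(b, b') \<in> R\<^sup>*" by (rule rtrancl_trans)
    moreover have "R \<subseteq> ?R" by (auto simp: R_def)
    ultimately have "(b, b') \<in> ?R\<^sup>*" using rtrancl_mono by blast
    moreover have "(s, b) \<in> ?R" "(b', t) \<in> ?R" using b b' BM by (auto simp: insert_commute)
    ultimately have "(s, t) \<in> ?R\<^sup>*"
      by (meson converse_rtrancl_into_rtrancl rtrancl_into_rtrancl)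
    then show ?thesis
      by (intro chordal_common_neighbours_adjacent[OF G st(3) SN[OF st(1)] SN[OF st(2)], of M])
        (auto simp: M_def)
  qed
  define G' where "G' = induced_subgraph G (B \<union> S)"
  have BS: "B \<union> S \<subseteq> verts G" using BM edgeD(2)[OF SN] unfolding M_def by blast
  have G': "verts G' = B \<union> S" "\<And>x y. {x, y} \<in> edges G' \<longleftrightarrow> {x, y} \<in> edges G \<and> x \<in> B \<union> S \<and> y \<in> B \<union> S"
    using BS by (auto simp: G'_def induced_subgraph_def)
  have "u \<notin> B \<union> S" using BM edgeD(3)[OF SN] unfolding M_def by blast
  then have smaller: "card (verts G') < card (verts G)"
    using BS less.prems G' by (intro psubset_card_mono) (auto simp: simple_graph_def)
  have IH: "\<exists>v \<in> verts G'. v \<noteq> x \<and> {x, v} \<notin> edges G' \<and> simplicial G' v"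
    if "x \<in> B \<union> S" "y \<in> B \<union> S" "y \<noteq> x" "{x, y} \<notin> edges G" for x y
    using less.hyps[OF smaller, of x y] that G' G
    by (auto simp: G'_def simple_graph_induced chordal_induced)
  have nbrs: "y \<in> B \<union> S" if "x \<in> B" "{x, y} \<in> edges G" for x y
    using that by (auto simp: S_def)
  have "\<exists>v \<in> B. simplicial G' v"
  proof (cases "\<exists>x \<in> B \<union> S. \<exists>y \<in> B \<union> S. y \<noteq> x \<and> {x, y} \<notin> edges G")
    \<comment> \<open>\<open>G'\<close> is complete, so any vertex of \<open>B\<close> is simplicial
      in it.\<close>
    case False
    have "simplicial G' w"
      unfolding simplicial_def clique_def
    proof (intro ballI impI)
      fix x y assume "x \<in> {z. {w, z} \<in> edges G'}" "y \<in> {z. {w, z} \<in> edges G'}" "x \<noteq> y"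
      then have "x \<in> B \<union> S" "y \<in> B \<union> S" "y \<noteq> x" using G'(2)[of w] by auto
      with False G'(2)[of x y] show "{x, y} \<in> edges G'" by metis
    qed
    then show ?thesis using wB by blast
  next
    case True
    show ?thesis
    proof (cases "\<exists>x \<in> S. \<exists>y \<in> B \<union> S. y \<noteq> x \<and> {x, y} \<notin> edges G")
      \<comment> \<open>A vertex \<open>v\<close> not adjacent to some other \<open>x\<close> in the
        clique \<open>S\<close> cannot lie in \<open>S\<close> itself.\<close>
      case True
      then obtain x y where x: "x \<in> S" "y \<in> B \<union> S" "y \<noteq> x" "{x, y} \<notin> edges G" by blast
      then obtain v where v: "v \<in> B \<union> S" "v \<noteq> x" "{x, v} \<notin> edges G'" "simplicial G' v"
        using IH[of x y] G'(1) by auto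
      then have "v \<notin> S" using Sclique[of x v] x G'(2) by auto
      then show ?thesis using v by blast
    next
      \<comment> \<open>Every vertex of \<open>S\<close> is adjacent to all others, so a vertex with
        a non-neighbour lies in \<open>B\<close>.\<close>
      case universal: False
      then obtain x y where x: "x \<in> B \<union> S" "y \<in> B \<union> S" "y \<noteq> x" "{x, y} \<notin> edges G"
        using True by blast
      then obtain v where v: "v \<in> B \<union> S" "v \<noteq> x" "{x, v} \<notin> edges G'" "simplicial G' v"
        using IH[of x y] G'(1) by auto
      then have "v \<notin> S" using universal x G'(2)[of x v] by (auto simp: insert_commute)
      then show ?thesis using v by blast
    qed
  qed
  then obtain v where v: "v \<in> B" "simplicial G' v" by blast
  \<comment> \<open>All neighbours of a vertex of \<open>B\<close> lie in \<open>B\<close> or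
    \<open>S\<close>, so passing from \<open>G'\<close> to \<open>G\<close> adds none.\<close>
  have "simplicial G v"
    unfolding simplicial_def clique_def
  proof (intro ballI impI)
    fix x y assume xy: "x \<in> {w. {v, w} \<in> edges G}" "y \<in> {w. {v, w} \<in> edges G}" "x \<noteq> y"
    then have "{v, x} \<in> edges G'" "{v, y} \<in> edges G'" using v(1) nbrs G'(2) by auto
    with v(2) xy(3) have "{x, y} \<in> edges G'" by (auto simp: simplicial_def clique_def)
    then show "{x, y} \<in> edges G" using G'(2) by blast
  qed
  with v(1) BM show ?case by (auto simp: M_def)
qed

lemma chordal_obtain_simplicial:
  assumes "simple_graph G" "chordal G" "verts G \<noteq> {}"
  obtains v where "v \<in> verts G" "simplicial G v"
proof (cases "\<exists>u \<in> verts G. \<exists>w \<in> verts G. w \<noteq> u \<and> {u, w} \<notin> edges G")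
  case True
  then show thesis using chordal_simplicial_nonneighbour[OF assms(1,2)] that by blast
next
  case False
  obtain v where "v \<in> verts G" using assms(3) by blast
  moreover have "simplicial G v"
    unfolding simplicial_def clique_def
  proof (intro ballI impI)
    fix x y assume "x \<in> {z. {v, z} \<in> edges G}" "y \<in> {z. {v, z} \<in> edges G}" "x \<noteq> y"
    then have "x \<in> verts G" "y \<in> verts G" "y \<noteq> x"
      using simple_graph_edgeD(2)[OF assms(1), of v] by simp_all
    with False show "{x, y} \<in> edges G" by metis
  qed
  ultimately show thesis using that by blast
qed

section \<open>Running intersection orderings\<close>

text \<open>Lists are read from their end: the head is the clique that enters the construction last.\<close>

fun running_intersection :: "'a set list \<Rightarrow> bool" where
  "running_intersection [] \<longleftrightarrow> True"
| "running_intersection (C # Cs) \<longleftrightarrow>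
     running_intersection Cs \<and> (Cs \<noteq> [] \<longrightarrow> (\<exists>D \<in> set Cs. C \<inter> \<Union> (set Cs) \<subseteq> D))"

text \<open>By distinctness the fresh \<open>v\<close> enters one member only, so no intersection of
  a member with the union of the later list entries changes.\<close>

lemma running_intersection_enlarge:
  assumes "running_intersection Cs" "distinct Cs" "v \<notin> \<Union> (set Cs)"
  shows "running_intersection (map (\<lambda>D. if D = N then insert v D else D) Cs)"
  using assms
proof (induction Cs)
  case (Cons C Cs)
  let ?f = "\<lambda>D. if D = N then insert v D else D"
  have un: "\<Union> (?f ` set Cs) \<subseteq> insert v (\<Union> (set Cs))" by auto
  have "\<exists>D \<in> ?f ` set Cs. ?f C \<inter> \<Union> (?f ` set Cs) \<subseteq> D" if ne: "Cs \<noteq> []"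
  proof -
    obtain D where D: "D \<in> set Cs" "C \<inter> \<Union> (set Cs) \<subseteq> D" using Cons.prems ne by auto
    show ?thesis
    proof (cases "C = N")
      case True
      then have "?f ` set Cs = set Cs" using Cons.prems by (auto simp: image_iff)
      moreover have "?f C \<inter> \<Union> (set Cs) \<subseteq> D" using D Cons.prems(3) by auto
      ultimately show ?thesis using D by auto
    next
      case False
      then have "?f C \<inter> \<Union> (?f ` set Cs) \<subseteq> ?f D" using D un Cons.prems(3) by auto
      then show ?thesis using D by blast
    qed
  qed
  with Cons show ?case by simp
qed simp

text \<open>Since \<open>N\<close> is a clique, \<open>insert v N\<close> is the only maximal clique
  through \<open>v\<close>. A maximal clique of \<open>G'\<close> stays maximal in \<open>G\<close>
  unless \<open>v\<close> can be added to it, which happens only for \<open>N\<close>.\<close>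

lemma max_clique_remove_simplicial:
  assumes "simple_graph G" "v \<in> verts G" "simplicial G v"
    and N: "N = {w. {v, w} \<in> edges G}" and G': "G' = induced_subgraph G (verts G - {v})"
  shows "max_clique G K \<longleftrightarrow> K = insert v N \<or> max_clique G' K \<and> K \<noteq> N"
proof -
  note edgeD = simple_graph_edgeD[OF assms(1)]
  have N_sub: "N \<subseteq> verts G - {v}" using edgeD(2,3)[of v] by (auto simp: N)
  have Ncl: "clique N (edges G)" using assms(3) by (simp add: simplicial_def N)
  have cl': "clique L (edges G') \<longleftrightarrow> clique L (edges G)" if "L \<subseteq> verts G - {v}" for L
    using that by (fastforce simp: clique_def G' induced_subgraph_def)
  have V': "verts G' = verts G - {v}" by (auto simp: G' induced_subgraph_def)
  have mc': "max_clique G' L \<longleftrightarrow> L \<subseteq> verts G - {v} \<and> clique L (edges G) \<and>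
      (\<forall>M. L \<subseteq> M \<and> M \<subseteq> verts G - {v} \<and> clique M (edges G) \<longrightarrow> M = L)" for L
    unfolding max_clique_def V' using cl' by meson
  have top_clique: "clique (insert v N) (edges G)"
    using Ncl by (auto simp: clique_def N insert_commute)
  have top_sub: "insert v N \<subseteq> verts G" using N_sub assms(2) by blast
  have in_top: "L \<subseteq> insert v N" if "v \<in> L" "clique L (edges G)" for L
    using that by (auto simp: clique_def N)
  have top: "max_clique G (insert v N)"
    using top_clique top_sub in_top unfolding max_clique_def by blast
  show ?thesis
  proof
    assume K: "max_clique G K"
    show "K = insert v N \<or> max_clique G' K \<and> K \<noteq> N"
    proof (cases "v \<in> K")
      case True
      then have "K \<subseteq> insert v N" using in_top K by (auto simp: max_clique_def)
      then show ?thesis using max_clique_subset_eq[OF K top] by blast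
    next
      case False
      then have "K \<subseteq> verts G - {v}" using K by (auto simp: max_clique_def)
      then have "max_clique G' K"
        unfolding mc' using max_cliqueD(2,3)[OF K] by (meson Diff_subset subset_trans)
      moreover have "K \<noteq> N" using max_clique_subset_eq[OF K top] False by blast
      ultimately show ?thesis by blast
    qed
  next
    assume "K = insert v N \<or> max_clique G' K \<and> K \<noteq> N"
    then show "max_clique G K"
    proof
      assume K: "max_clique G' K \<and> K \<noteq> N"
      then have Ks: "K \<subseteq> verts G - {v}" "clique K (edges G)"
        by (simp_all add: mc')
      have max': "L = K" if "K \<subseteq> L" "L \<subseteq> verts G - {v}" "clique L (edges G)" for L
        using that K by (simp add: mc')
      have "L = K" if L: "K \<subseteq> L" "L \<subseteq> verts G" "clique L (edges G)" for L
      proof (cases "v \<in> L")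
        \<comment> \<open>Here \<open>K\<close> lies in the clique \<open>N\<close> of
          \<open>G'\<close>, so maximality in \<open>G'\<close> would force
          \<open>K = N\<close>.\<close>
        case True
        then have "K \<subseteq> N" using in_top L Ks(1) by blast
        then show ?thesis using max'[of N] N_sub Ncl K by blast
      qed (use L max' in blast)
      then show ?thesis using Ks unfolding max_clique_def by blast
    qed (use top in simp)
  qed
qed

text \<open>Induction by deleting a simplicial vertex \<open>v\<close> with neighbourhood
  \<open>N\<close>. If \<open>N\<close> is maximal in the rest, it is enlarged by \<open>v\<close>
  in place; otherwise \<open>insert v N\<close> becomes the new head.\<close>

lemma chordal_running_intersection:
  assumes "simple_graph G" "chordal G"
  shows "\<exists>Cs. distinct Cs \<and> set Cs = {K. max_clique G K} \<and> running_intersection Cs"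
  using assms
proof (induction "card (verts G)" arbitrary: G rule: less_induct)
  case less
  show ?case
  proof (cases "verts G = {}")
    case True
    \<comment> \<open>The graph without vertices still has one maximal clique, the empty
      set.\<close>
    then have "{K. max_clique G K} = {{}}" by (auto simp: max_clique_def clique_def)
    then show ?thesis by (intro exI[of _ "[{}]"]) simp
  next
    case False
    then obtain v where v: "v \<in> verts G" "simplicial G v"
      using chordal_obtain_simplicial less.prems by blast
    define N where "N = {w. {v, w} \<in> edges G}"
    define G' where "G' = induced_subgraph G (verts G - {v})"
    have mc: "max_clique G K \<longleftrightarrow> K = insert v N \<or> max_clique G' K \<and> K \<noteq> N" for K
      using max_clique_remove_simplicial[OF less.prems(1) v N_def G'_def] .
    have V': "verts G' = verts G - {v}" by (auto simp: G'_def induced_subgraph_def)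
    have fin: "finite (verts G)" using less.prems by (simp add: simple_graph_def)
    have "card (verts G') < card (verts G)"
      unfolding V' using v fin by (metis card_Diff1_less)
    from less.hyps[OF this] obtain Cs where
      Cs: "distinct Cs" "set Cs = {K. max_clique G' K}" "running_intersection Cs"
      using less.prems by (auto simp: G'_def simple_graph_induced chordal_induced)
    have vn: "v \<notin> \<Union> (set Cs)" using Cs(2) V' by (auto simp: max_clique_def)
    show ?thesis
    proof (cases "max_clique G' N")
      case True
      let ?f = "\<lambda>D. if D = N then insert v D else D"
      have "inj_on ?f (set Cs)" using vn by (auto simp: inj_on_def)
      then have "distinct (map ?f Cs)" using Cs(1) by (simp add: distinct_map)
      moreover have "set (map ?f Cs) = {K. max_clique G K}"
        using True Cs(2) mc by (auto simp: image_iff)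
      ultimately show ?thesis
        using running_intersection_enlarge[OF Cs(3,1) vn, of N] by blast
    next
      case False
      have "N \<subseteq> verts G'"
        using simple_graph_edgeD(2,3)[OF less.prems(1), of v] by (auto simp: N_def V')
      moreover have "clique N (edges G')"
        unfolding clique_def
      proof (intro ballI impI)
        fix x y assume xy: "x \<in> N" "y \<in> N" "x \<noteq> y"
        then have "{x, y} \<in> edges G" using v(2) by (simp add: simplicial_def clique_def N_def)
        with xy \<open>N \<subseteq> verts G'\<close> show "{x, y} \<in> edges G'"
          by (auto simp: V' G'_def induced_subgraph_def)
      qed
      moreover have "finite (verts G')" using fin V' by simp
      ultimately obtain D where D: "max_clique G' D" "N \<subseteq> D"
        using clique_extends_to_max_clique by metis
      \<comment> \<open>\<open>v\<close> occurs in no member of \<open>Cs\<close>, so the new clique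
        meets their union inside \<open>N\<close>, hence inside \<open>D\<close>.\<close>
      have "running_intersection (insert v N # Cs)"
        using Cs D vn by auto
      moreover have "distinct (insert v N # Cs)" using Cs(1) vn by auto
      moreover have "set (insert v N # Cs) = {K. max_clique G K}"
        using False Cs(2) mc by auto
      ultimately show ?thesis by blast
    qed
  qed
qed

section \<open>Invariants of the clique graph construction\<close>

text \<open>\<open>H\<close> is the union of the complete graphs on the nodes of \<open>T\<close>.
  The last clause is the connectivity condition of tree decompositions, stated for a
  \<open>T\<close> that may contain cycles.\<close>

definition run_invariant :: "'a ugraph \<Rightarrow> 'a ugraph \<Rightarrow> 'a set ugraph \<Rightarrow> bool" where
  "run_invariant G H T \<longleftrightarrow>
     (\<forall>C \<in> verts T. max_clique G C) \<and>
     verts H = \<Union> (verts T) \<and> edges H = (\<Union>C \<in> verts T. [C]\<^bsup>2\<^esup>) \<and>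
     edges T \<subseteq> [verts T]\<^bsup>2\<^esup> \<and>
     (\<forall>v. \<forall>C \<in> verts T. \<forall>D \<in> verts T. v \<in> C \<longrightarrow> v \<in> D \<longrightarrow>
        (C, D) \<in> {(X, Y). {X, Y} \<in> edges T \<and> v \<in> X \<and> v \<in> Y}\<^sup>*)"

lemma run_invariant_new_clique:
  assumes "run_invariant G H T" "\<not> subgraph (complete_graph C) H"
  shows "C \<notin> verts T"
  using assms by (auto simp: run_invariant_def subgraph_def complete_graph_def)

text \<open>The clique \<open>{v}\<close> extends to a maximal one. This supplies the
  \<open>S\<close> through which an old vertex \<open>v\<close> of \<open>C\<close> is linked to an
  earlier node.\<close>

lemma in_meeting_clique:
  assumes "finite C" "v \<in> C" "v \<in> verts H"
  obtains S where "S \<in> meeting_cliques H C" "v \<in> S"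
proof -
  let ?I = "induced_subgraph H (C \<inter> verts H)"
  have "finite (verts ?I)" "{v} \<subseteq> verts ?I" "clique {v} (edges ?I)"
    using assms by (auto simp: induced_subgraph_def clique_def)
  then obtain S where "max_clique ?I S" "{v} \<subseteq> S" using clique_extends_to_max_clique by metis
  then show thesis using that by (auto simp: meeting_cliques_def)
qed

text \<open>Serves both rules of the construction; in the disjoint case \<open>F\<close> is empty
  and \<open>cover\<close> is vacuous. Old nodes containing \<open>v\<close> are already connected,
  and \<open>cover\<close> links \<open>C\<close> to one of them.\<close>

lemma run_invariant_add_clique:
  assumes inv: "run_invariant G H T" and C: "max_clique G C" "C \<notin> verts T"
    and F: "F \<subseteq> {{C, D} | D. D \<in> verts T}"
    and cover: "\<And>v. v \<in> C \<Longrightarrow> v \<in> verts H \<Longrightarrow> \<exists>D \<in> verts T. v \<in> D \<and> {C, D} \<in> F"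
  shows "run_invariant G (graph_union H (complete_graph C))
           \<lparr>verts = insert C (verts T), edges = edges T \<union> F\<rparr>"
proof -
  let ?T = "\<lparr>verts = insert C (verts T), edges = edges T \<union> F\<rparr>"
  have VT: "verts H = \<Union> (verts T)" and ET: "edges T \<subseteq> [verts T]\<^bsup>2\<^esup>"
    using inv by (simp_all add: run_invariant_def)
  have "F \<subseteq> [insert C (verts T)]\<^bsup>2\<^esup>"
  proof
    fix e assume "e \<in> F"
    then obtain D where "e = {C, D}" "D \<in> verts T" using F by blast
    then show "e \<in> [insert C (verts T)]\<^bsup>2\<^esup>" using C(2) by auto
  qed
  moreover have "[verts T]\<^bsup>2\<^esup> \<subseteq> [insert C (verts T)]\<^bsup>2\<^esup>" by (rule nsets_mono) blast
  ultimately have E': "edges ?T \<subseteq> [verts ?T]\<^bsup>2\<^esup>" using ET by auto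
  have conn: "(A, B) \<in> {(X, Y). {X, Y} \<in> edges ?T \<and> v \<in> X \<and> v \<in> Y}\<^sup>*"
    if AB: "A \<in> verts ?T" "B \<in> verts ?T" "v \<in> A" "v \<in> B" for v A B
  proof -
    let ?R = "{(X, Y). {X, Y} \<in> edges T \<and> v \<in> X \<and> v \<in> Y}"
    let ?R' = "{(X, Y). {X, Y} \<in> edges ?T \<and> v \<in> X \<and> v \<in> Y}"
    have "sym ?R'" by (auto simp: sym_def insert_commute)
    then have sym: "sym (?R'\<^sup>*)" by (rule sym_rtrancl)
    have old: "(X, Y) \<in> ?R'\<^sup>*" if "X \<in> verts T" "Y \<in> verts T" "v \<in> X" "v \<in> Y" for X Y
    proof -
      have "(X, Y) \<in> ?R\<^sup>*" using inv that by (simp add: run_invariant_def)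
      moreover have "?R \<subseteq> ?R'" by auto
      ultimately show ?thesis using rtrancl_mono by blast
    qed
    have new: "(C, Y) \<in> ?R'\<^sup>*" if Y: "Y \<in> verts T" "v \<in> C" "v \<in> Y" for Y
    proof -
      obtain D where D: "D \<in> verts T" "v \<in> D" "{C, D} \<in> F"
        using cover[of v] Y VT by blast
      then have "(C, D) \<in> ?R'" using Y by simp
      with old[OF D(1) Y(1) D(2) Y(3)] show ?thesis by (meson converse_rtrancl_into_rtrancl)
    qed
    show ?thesis using AB old new symD[OF sym new] by auto
  qed
  show ?thesis
    unfolding run_invariant_def
  proof (intro conjI)
    show "\<forall>v. \<forall>A \<in> verts ?T. \<forall>B \<in> verts ?T. v \<in> A \<longrightarrow> v \<in> B \<longrightarrow>
        (A, B) \<in> {(X, Y). {X, Y} \<in> edges ?T \<and> v \<in> X \<and> v \<in> Y}\<^sup>*"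
      using conn by blast
  qed (use inv C E' in \<open>auto simp: run_invariant_def graph_union_def complete_graph_def\<close>)
qed

lemma clique_graph_run_invariant:
  assumes "clique_graph_run G H T" "finite (verts G)"
  shows "run_invariant G H T"
  using assms
proof (induction rule: clique_graph_run.induct)
  case start
  then show ?case by (simp add: run_invariant_def empty_graph_def)
next
  case (disjoint H T C)
  then have "C \<notin> verts T" using run_invariant_new_clique by blast
  with disjoint show ?case
    using run_invariant_add_clique[of G H T C "{}"] by auto
next
  case (meeting H T C f)
  then have inv: "run_invariant G H T" by blast
  have nC: "C \<notin> verts T" using run_invariant_new_clique meeting inv by blast
  have "finite C" using meeting.hyps(2) \<open>finite (verts G)\<close>
    by (auto simp: max_clique_def intro: finite_subset)
  show ?case
  proof (rule run_invariant_add_clique[OF inv meeting.hyps(2) nC])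
    show "{{C, f S} | S. S \<in> meeting_cliques H C} \<subseteq> {{C, D} | D. D \<in> verts T}"
      using meeting.hyps by blast
  next
    fix v assume "v \<in> C" "v \<in> verts H"
    then obtain S where "S \<in> meeting_cliques H C" "v \<in> S"
      using in_meeting_clique[OF \<open>finite C\<close>] by blast
    then show "\<exists>D \<in> verts T. v \<in> D \<and> {C, D} \<in> {{C, f S} | S. S \<in> meeting_cliques H C}"
      using meeting.hyps by blast
  qed
qed

text \<open>A walk in \<open>H\<close> lifts to \<open>T\<close>: each edge of \<open>H\<close> lies
  in some node, and nodes sharing a vertex are connected in \<open>T\<close>.\<close>

lemma run_invariant_connected:
  assumes inv: "run_invariant G H T" and walk: "(x, y) \<in> {(a, b). {a, b} \<in> edges H}\<^sup>*"
    and AB: "A \<in> verts T" "x \<in> A" "B \<in> verts T" "y \<in> B"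
  shows "(A, B) \<in> {(X, Y). {X, Y} \<in> edges T}\<^sup>*"
proof -
  let ?R = "{(X, Y). {X, Y} \<in> edges T}"
  have same: "(X, Y) \<in> ?R\<^sup>*" if "X \<in> verts T" "Y \<in> verts T" "v \<in> X" "v \<in> Y" for v X Y
  proof -
    have "(X, Y) \<in> {(X, Y). {X, Y} \<in> edges T \<and> v \<in> X \<and> v \<in> Y}\<^sup>*"
      using inv that by (simp add: run_invariant_def)
    then show ?thesis by (rule rtrancl_mono[THEN subsetD, rotated]) auto
  qed
  show ?thesis using walk AB(3,4)
  proof (induction arbitrary: B rule: rtrancl_induct)
    case base
    then show ?case using same AB by blast
  next
    case (step y z)
    then have "{y, z} \<in> (\<Union>C \<in> verts T. [C]\<^bsup>2\<^esup>)" using inv by (simp add: run_invariant_def)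
    then obtain D where "D \<in> verts T" "y \<in> D" "z \<in> D" by auto
    then show ?case using step.IH[of D] same[of D B z] step.prems by (meson rtrancl_trans)
  qed
qed

section \<open>Acyclic clique graphs and chordality\<close>

text \<open>\<open>separated\<close> says that attachment vertices in one component of
  \<open>H\<close> are already adjacent. A long cycle either lies in \<open>H\<close> or uses a new
  edge; in the latter case it has a third vertex in \<open>C\<close>, or the rest of it is a walk in
  \<open>H\<close> and \<open>separated\<close> applies to the ends of the new edge.\<close>

lemma chordal_add_clique:
  assumes H: "chordal H" "edges H \<subseteq> [verts H]\<^bsup>2\<^esup>"
    and separated: "\<And>x y. x \<in> C \<inter> verts H \<Longrightarrow> y \<in> C \<inter> verts H \<Longrightarrow>
        (x, y) \<in> {(a, b). {a, b} \<in> edges H}\<^sup>* \<Longrightarrow> x \<noteq> y \<Longrightarrow> {x, y} \<in> edges H"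
  shows "chordal (graph_union H (complete_graph C))"
  unfolding chordal_def
proof (intro allI impI)
  let ?H = "graph_union H (complete_graph C)"
  fix c assume c: "is_cycle ?H c \<and> 4 \<le> length c"
  show "has_chord ?H c"
  proof (cases "cycle_edges c \<subseteq> edges H")
    case True
    have "set c \<subseteq> verts H"
    proof
      fix x assume "x \<in> set c"
      then obtain i where i: "i < length c" "x = c ! i" by (auto simp: in_set_conv_nth)
      then have "{x, c ! (Suc i mod length c)} \<in> cycle_edges c" by (auto simp: cycle_edges_def)
      with True H(2) have "{x, c ! (Suc i mod length c)} \<in> [verts H]\<^bsup>2\<^esup>" by blast
      then show "x \<in> verts H" by simp
    qed
    with True c have "is_cycle H c" by (simp add: is_cycle_def)
    with H(1) c have "has_chord H c" by (simp add: chordal_def)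
    then show ?thesis by (fastforce simp: has_chord_def graph_union_def)
  next
    case False
    then obtain i where i: "i < length c" "{c ! i, c ! (Suc i mod length c)} \<notin> edges H"
      by (auto simp: cycle_edges_def)
    \<comment> \<open>This rotation makes the new edge the closing edge, between positions
      \<open>n - 1\<close> and 0.\<close>
    define d where "d = rotate (Suc i) c"
    define n where "n = length d"
    have d: "is_cycle ?H d" and n: "4 \<le> n"
      using c unfolding d_def n_def by (simp_all only: is_cycle_rotate length_rotate)
    then have dist: "distinct d" and dE: "cycle_edges d \<subseteq> edges ?H" by (auto simp: is_cycle_def)
    have nc: "n = length c" "c \<noteq> []" using i by (auto simp: n_def d_def)
    have "d ! 0 = c ! (Suc i mod n)" using nc nth_rotate[of 0 c "Suc i"] by (simp add: d_def del: rotate_Suc)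
    moreover have "d ! (n - 1) = c ! i"
    proof -
      have "Suc i + (n - 1) = i + n" using n by simp
      then show ?thesis
        using nc i nth_rotate[of "n - 1" c "Suc i"] by (simp add: d_def del: rotate_Suc)
    qed
    ultimately have bad: "{d ! 0, d ! (n - 1)} \<notin> edges H" using i nc by (simp add: insert_commute)
    have in_C: "x \<in> C" "y \<in> C" if "{x, y} \<in> edges ?H" "{x, y} \<notin> edges H" for x y
      using that by (auto simp: graph_union_def complete_graph_def)
    have ce: "{d ! k, d ! l} \<in> cycle_edges d \<longleftrightarrow> l = Suc k mod n \<or> k = Suc l mod n"
      if "k < n" "l < n" for k l
      using nth_doubleton_in_cycle_edges_iff[OF dist] that by (simp add: n_def)
    have "{d ! 0, d ! (n - 1)} \<in> cycle_edges d" using n by (subst ce) auto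
    then have ends: "d ! 0 \<in> C" "d ! (n - 1) \<in> C" using in_C bad dE by blast+
    have C_adj: "{x, y} \<in> edges ?H" if "x \<in> C" "y \<in> C" "x \<noteq> y" for x y
      using that by (auto simp: graph_union_def complete_graph_def)
    have "has_chord ?H d"
    proof (cases "\<exists>k. 0 < k \<and> k < n - 1 \<and> d ! k \<in> C")
      case True
      then obtain k where k: "0 < k" "k < n - 1" "d ! k \<in> C" by blast
      \<comment> \<open>As \<open>n\<close> is at least 4, position \<open>k\<close> is not
        cyclically next to both ends; \<open>l\<close> is an end it is not next to.\<close>
      define l where "l = (if k = 1 then n - 1 else 0)"
      have l: "l < n" "l \<noteq> k" "d ! l \<in> C" using k n ends by (auto simp: l_def)
      have "{d ! k, d ! l} \<notin> cycle_edges d"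
        using k n l by (subst ce) (auto simp: l_def)
      moreover have "{d ! k, d ! l} \<in> edges ?H"
        using C_adj k l dist by (simp add: nth_eq_iff_index_eq n_def)
      moreover have "d ! k \<in> set d" "d ! l \<in> set d" using k l by (simp_all add: n_def)
      ultimately show ?thesis unfolding has_chord_def by blast
    next
      case False
      \<comment> \<open>A new edge has both ends in \<open>C\<close>, but no inner position does,
        and two successive positions cannot be 0 and \<open>n - 1\<close>. So all edges except the
        closing one are old.\<close>
      have step: "{d ! k, d ! Suc k} \<in> edges H" if k: "Suc k < n" for k
      proof (rule ccontr)
        assume *: "{d ! k, d ! Suc k} \<notin> edges H"
        have "{d ! k, d ! Suc k} \<in> cycle_edges d" using k by (subst ce) auto
        then have "d ! k \<in> C" "d ! Suc k \<in> C" using in_C * dE by blast+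
        then have "\<not> (0 < k \<and> k < n - 1)" "\<not> (0 < Suc k \<and> Suc k < n - 1)" using False by blast+
        with k n show False by linarith
      qed
      have walk: "(d ! 0, d ! k) \<in> {(a, b). {a, b} \<in> edges H}\<^sup>*" if "k < n" for k
        using that
      proof (induction k)
        case (Suc k)
        then show ?case using step[of k] by (auto intro: rtrancl_into_rtrancl)
      qed simp
      have pred: "Suc (n - 2) = n - 1" using n by simp
      have "{d ! 0, d ! 1} \<in> edges H" "{d ! (n - 2), d ! (n - 1)} \<in> edges H"
        using step[of 0] step[of "n - 2"] n by (simp_all add: pred)
      then have "{d ! 0, d ! 1} \<in> [verts H]\<^bsup>2\<^esup>" "{d ! (n - 2), d ! (n - 1)} \<in> [verts H]\<^bsup>2\<^esup>"
        using H(2) by blast+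
      then have "d ! 0 \<in> verts H" "d ! (n - 1) \<in> verts H" by simp_all
      moreover have "d ! 0 \<noteq> d ! (n - 1)"
        using n unfolding n_def by (subst nth_eq_iff_index_eq[OF dist]) auto
      moreover have "(d ! 0, d ! (n - 1)) \<in> {(a, b). {a, b} \<in> edges H}\<^sup>*" using walk n by simp
      ultimately have "{d ! 0, d ! (n - 1)} \<in> edges H" using separated ends by blast
      with bad show ?thesis by blast
    qed
    then show ?thesis by (simp only: d_def has_chord_rotate)
  qed
qed

lemma run_invariant_edges: "run_invariant G H T \<Longrightarrow> edges H \<subseteq> [verts H]\<^bsup>2\<^esup>"
  by (auto simp: run_invariant_def nsets_def)

text \<open>Clique graphs only grow during a run, so acyclicity passes back to earlier states and
  induction along the run applies. It remains to check the separation condition of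
  \<open>chordal_add_clique\<close>, which is vacuous for a disjoint clique.\<close>

lemma clique_graph_run_acyclic_imp_chordal:
  assumes "clique_graph_run G H T" "finite (verts G)" "\<nexists>c. is_cycle T c"
  shows "chordal H"
  using assms
proof (induction rule: clique_graph_run.induct)
  case start
  then show ?case by (auto simp: chordal_def is_cycle_def empty_graph_def)
next
  case (disjoint H T C)
  then have "\<nexists>c. is_cycle T c" by (auto simp: is_cycle_def)
  with disjoint have "chordal H" by blast
  with disjoint show ?case
    using clique_graph_run_invariant run_invariant_edges
    by (intro chordal_add_clique) blast+
next
  case (meeting H T C f)
  let ?T = "\<lparr>verts = insert C (verts T),
    edges = edges T \<union> {{C, f S} | S. S \<in> meeting_cliques H C}\<rparr>"
  have inv: "run_invariant G H T" using meeting clique_graph_run_invariant by blast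
  have nC: "C \<notin> verts T" using run_invariant_new_clique meeting inv by blast
  have fin: "finite C" using meeting.hyps(2) \<open>finite (verts G)\<close>
    by (auto simp: max_clique_def intro: finite_subset)
  have "\<nexists>c. is_cycle T c" using meeting.prems(2) by (fastforce simp: is_cycle_def)
  then have "chordal H" using meeting by blast
  then show ?case
  proof (rule chordal_add_clique[OF _ run_invariant_edges[OF inv]])
    fix x y assume xy: "x \<in> C \<inter> verts H" "y \<in> C \<inter> verts H" "x \<noteq> y"
      and walk: "(x, y) \<in> {(a, b). {a, b} \<in> edges H}\<^sup>*"
    obtain S where S: "S \<in> meeting_cliques H C" "x \<in> S"
      using in_meeting_clique[OF fin, of x H] xy(1) by blast
    obtain S' where S': "S' \<in> meeting_cliques H C" "y \<in> S'"
      using in_meeting_clique[OF fin, of y H] xy(2) by blast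
    have f: "f S \<in> verts T" "x \<in> f S" "f S' \<in> verts T" "y \<in> f S'"
      using meeting.hyps(5)[OF S(1)] meeting.hyps(5)[OF S'(1)] S(2) S'(2) by blast+
    \<comment> \<open>The walk in \<open>H\<close> connects these two nodes in \<open>T\<close>;
      were they distinct, the two edges at \<open>C\<close> would close a cycle. As they agree,
      \<open>x\<close> and \<open>y\<close> share a node and are adjacent.\<close>
    have "f S = f S'"
    proof (rule ccontr)
      assume ne: "f S \<noteq> f S'"
      have "\<exists>c. is_cycle ?T c"
        using S(1) S'(1) f nC inv
        by (intro cycle_through_new_vertex[OF run_invariant_connected[OF inv walk f] ne])
          (auto simp: run_invariant_def)
      with meeting.prems(2) show False by blast
    qed
    with f xy(3) have "{x, y} \<in> [f S]\<^bsup>2\<^esup>" by simp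
    with f(1) inv show "{x, y} \<in> edges H" by (auto simp: run_invariant_def)
  qed
qed

section \<open>Acyclic runs along running intersection orderings\<close>

text \<open>Each entering clique \<open>C\<close> meets the current subgraph inside a single earlier
  clique \<open>D\<close>. The meeting part is then a clique, so \<open>C\<close> is attached by the
  one edge to \<open>D\<close>, or by none.\<close>

lemma running_intersection_imp_acyclic_run:
  assumes "finite (verts G)" "running_intersection Cs" "distinct Cs"
    "\<And>C. C \<in> set Cs \<Longrightarrow> max_clique G C"
    and ne: "verts G \<noteq> {}"
  shows "\<exists>H T. clique_graph_run G H T \<and> verts T = set Cs \<and> (\<nexists>c. is_cycle T c)"
  using assms(2-4)
proof (induction Cs)
  case Nil
  have "verts empty_graph = set ([] :: 'a set list)" "\<nexists>c. is_cycle (empty_graph :: 'a set ugraph) c"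
    by (auto simp: empty_graph_def is_cycle_def)
  then show ?case using clique_graph_run.start by blast
next
  case (Cons C Cs)
  then obtain H T where run: "clique_graph_run G H T" "verts T = set Cs" and ac: "\<nexists>c. is_cycle T c"
    by auto
  have inv: "run_invariant G H T" using clique_graph_run_invariant[OF run(1) assms(1)] .
  then have VH: "verts H = \<Union> (set Cs)" and ET: "edges T \<subseteq> [verts T]\<^bsup>2\<^esup>"
    using run(2) by (simp_all add: run_invariant_def)
  have C: "max_clique G C" "C \<noteq> {}" "C \<notin> verts T"
    using Cons.prems run(2) max_clique_nonempty[OF ne] by auto
  show ?case
  proof (cases "C \<inter> verts H = {}")
    case True
    \<comment> \<open>Nonemptiness of \<open>C\<close> matters: the complete graph on the empty set
      is a subgraph of every \<open>H\<close>.\<close>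
    then have new: "\<not> subgraph (complete_graph C) H"
      using C by (auto simp: subgraph_def complete_graph_def)
    have "\<nexists>c. is_cycle \<lparr>verts = insert C (verts T), edges = edges T\<rparr> c"
      using acyclic_add_pendant[OF ac ET C(3), of "{}"] by simp
    then show ?thesis
      using clique_graph_run.disjoint[OF run(1) C(1) new True] run(2) by fastforce
  next
    case False
    then have "Cs \<noteq> []" using VH by auto
    then obtain D where D: "D \<in> set Cs" "C \<inter> verts H \<subseteq> D" using Cons.prems VH by auto
    then have Dmax: "max_clique G D" using Cons.prems by simp
    have new: "\<not> subgraph (complete_graph C) H"
    proof
      assume "subgraph (complete_graph C) H"
      then have "C \<subseteq> D" using D by (auto simp: subgraph_def complete_graph_def)
      then have "C = D" using max_clique_subset_eq C(1) Dmax by blast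
      then show False using D C(3) run(2) by simp
    qed
    have "{x, y} \<in> edges H" if "x \<in> C \<inter> verts H" "y \<in> C \<inter> verts H" "x \<noteq> y" for x y
    proof -
      have "{x, y} \<in> [D]\<^bsup>2\<^esup>" using that D by auto
      then show ?thesis using inv D(1) run(2) by (auto simp: run_invariant_def)
    qed
    then have full: "clique (C \<inter> verts H) (edges (induced_subgraph H (C \<inter> verts H)))"
      by (auto simp: clique_def induced_subgraph_def)
    \<comment> \<open>The meeting part is itself a clique, so it is its own only maximal
      clique.\<close>
    have MC: "S = C \<inter> verts H" if "S \<in> meeting_cliques H C" for S
    proof -
      have S: "max_clique (induced_subgraph H (C \<inter> verts H)) S"
        using that by (simp add: meeting_cliques_def)
      have V: "verts (induced_subgraph H (C \<inter> verts H)) = C \<inter> verts H"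
        by (auto simp: induced_subgraph_def)
      show ?thesis using max_cliqueD(1,3)[OF S] full unfolding V by blast
    qed
    let ?F = "{{C, D} | S. S \<in> meeting_cliques H C}"
    have "clique_graph_run G (graph_union H (complete_graph C))
        \<lparr>verts = insert C (verts T), edges = edges T \<union> ?F\<rparr>"
      using clique_graph_run.meeting[OF run(1) C(1) new False, of "\<lambda>_. D"] MC Dmax D run(2) by blast
    moreover have "\<nexists>c. is_cycle \<lparr>verts = insert C (verts T), edges = edges T \<union> ?F\<rparr> c"
      by (rule acyclic_add_pendant[OF ac ET C(3), of _ D]) blast
    ultimately show ?thesis using run(2) by fastforce
  qed
qed

text \<open>Every vertex and every edge extends to a maximal clique, and the invariant makes
  \<open>H\<close> the union of the nodes.\<close>

lemma run_with_all_max_cliques_complete: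
  assumes G: "simple_graph G" and inv: "run_invariant G H T" and T: "verts T = {K. max_clique G K}"
  shows "H = G"
proof -
  have fin: "finite (verts G)" using G by (simp add: simple_graph_def)
  have "verts G = \<Union> (verts T)"
  proof
    show "verts G \<subseteq> \<Union> (verts T)"
    proof
      fix x assume "x \<in> verts G"
      then obtain K where "max_clique G K" "{x} \<subseteq> K"
        using clique_extends_to_max_clique[OF fin, of "{x}"] by (auto simp: clique_def)
      then show "x \<in> \<Union> (verts T)" using T by auto
    qed
  qed (use T in \<open>auto simp: max_clique_def\<close>)
  moreover have "edges G = (\<Union>C \<in> verts T. [C]\<^bsup>2\<^esup>)"
  proof
    show "edges G \<subseteq> (\<Union>C \<in> verts T. [C]\<^bsup>2\<^esup>)"
    proof
      fix e assume e: "e \<in> edges G"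
      then have e2: "e \<in> [verts G]\<^bsup>2\<^esup>" using G by (auto simp: simple_graph_def)
      then obtain x y where xy: "e = {x, y}" "x \<noteq> y" by (auto simp: nsets_def card_2_iff)
      have "clique e (edges G)" using e xy by (auto simp: clique_def insert_commute)
      moreover have "e \<subseteq> verts G" using e2 by (auto simp: nsets_def)
      ultimately obtain K where "max_clique G K" "e \<subseteq> K"
        using clique_extends_to_max_clique[OF fin] by blast
      then show "e \<in> (\<Union>C \<in> verts T. [C]\<^bsup>2\<^esup>)" using T xy by auto
    qed
    show "(\<Union>C \<in> verts T. [C]\<^bsup>2\<^esup>) \<subseteq> edges G"
    proof
      fix e assume "e \<in> (\<Union>C \<in> verts T. [C]\<^bsup>2\<^esup>)"
      then obtain K where K: "max_clique G K" "e \<in> [K]\<^bsup>2\<^esup>" using T by auto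
      then obtain x y where "e = {x, y}" "x \<noteq> y" "x \<in> K" "y \<in> K"
        by (auto simp: nsets_def card_2_iff)
      then show "e \<in> edges G" using max_cliqueD(2)[OF K(1)] by (auto simp: clique_def)
    qed
  qed
  ultimately show ?thesis using inv by (simp add: run_invariant_def)
qed

section \<open>Leaves and non-public vertices\<close>

lemma leaf_non_public_part:
  assumes inv: "run_invariant G G T" and leaf: "is_leaf T C"
  shows "non_public_part G C \<noteq> {}"
proof
  assume empty: "non_public_part G C = {}"
  have CT: "C \<in> verts T" and "card {e \<in> edges T. C \<in> e} = 1"
    using leaf by (simp_all add: is_leaf_def degree_def)
  then obtain e where e: "{e \<in> edges T. C \<in> e} = {e}" by (auto simp: card_1_singleton_iff)
  then have "e \<in> edges T" "C \<in> e" by auto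
  moreover have "edges T \<subseteq> [verts T]\<^bsup>2\<^esup>" using inv by (simp add: run_invariant_def)
  ultimately have "e \<in> [verts T]\<^bsup>2\<^esup>" by blast
  then obtain A B where AB: "e = {A, B}" "A \<in> verts T" "B \<in> verts T" "A \<noteq> B"
    by (auto simp: nsets_def card_2_iff)
  with \<open>C \<in> e\<close> have "C = A \<or> C = B" by simp
  then obtain D where D: "e = {C, D}" "D \<noteq> C" "D \<in> verts T"
    using AB by (metis insert_commute)
  have max: "max_clique G X" if "X \<in> verts T" for X using that inv by (simp add: run_invariant_def)
  have "C \<subseteq> D"
  proof
    fix v assume v: "v \<in> C"
    then obtain K where K: "max_clique G K" "K \<noteq> C" "v \<in> K"
      using empty by (auto simp: non_public_part_def public_part_def)
    \<comment> \<open>\<open>K\<close> need not be a node, because a run can reach \<open>G\<close>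
      without using every maximal clique. If \<open>C\<close> were the only node containing
      \<open>v\<close>, all neighbours of \<open>v\<close> would lie in \<open>C\<close>, and so
      would \<open>K\<close>.\<close>
    have "\<exists>X \<in> verts T. X \<noteq> C \<and> v \<in> X"
    proof (rule ccontr)
      assume *: "\<not> (\<exists>X \<in> verts T. X \<noteq> C \<and> v \<in> X)"
      have "K \<subseteq> C"
      proof
        fix w assume w: "w \<in> K"
        show "w \<in> C"
        proof (cases "w = v")
          case False
          then have "{v, w} \<in> edges G" using K w by (auto simp: max_clique_def clique_def)
          then have "{v, w} \<in> (\<Union>C \<in> verts T. [C]\<^bsup>2\<^esup>)" using inv by (simp add: run_invariant_def)
          then obtain X where "X \<in> verts T" "v \<in> X" "w \<in> X" by auto
          with * show ?thesis by blast
        qed (use v in simp)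
      qed
      then show False using max_clique_subset_eq[OF K(1) max[OF CT]] K(2) by blast
    qed
    then obtain X where X: "X \<in> verts T" "X \<noteq> C" "v \<in> X" by blast
    then have "(C, X) \<in> {(X, Y). {X, Y} \<in> edges T \<and> v \<in> X \<and> v \<in> Y}\<^sup>*"
      using inv v CT by (simp add: run_invariant_def)
    \<comment> \<open>The first edge of the walk leaves the leaf \<open>C\<close>, so it is the edge
      to \<open>D\<close>.\<close>
    then obtain Y where Y: "{C, Y} \<in> edges T" "v \<in> Y"
      using X(2) by (auto elim: converse_rtranclE)
    then have "{C, Y} \<in> {e \<in> edges T. C \<in> e}" by simp
    then have "{C, Y} = {C, D}" using e D(1) by simp
    then show "v \<in> D" using Y(2) by (metis doubleton_eq_iff)
  qed
  then show False using max_clique_subset_eq[OF max[OF CT] max[OF D(3)]] D(2) by blast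
qed

theorem theorem5:
  fixes G :: "'a ugraph"
  assumes "simple_graph G" and "connected_graph G"
  shows "(chordal G \<longleftrightarrow> (\<exists>Gc \<in> clique_graphs G. is_tree Gc)) \<and>
    (chordal G \<longrightarrow>
      (\<forall>Gc \<in> clique_graphs G. \<forall>C. is_leaf Gc C \<longrightarrow> non_public_part G C \<noteq> {}))"
proof (intro conjI iffI)
  have fin: "finite (verts G)" and ne: "verts G \<noteq> {}"
    using assms by (simp_all add: simple_graph_def connected_graph_def)
  have inv: "run_invariant G G T" if "T \<in> clique_graphs G" for T
    using that clique_graph_run_invariant fin by (auto simp: clique_graphs_def)
  show "chordal G" if "\<exists>Gc \<in> clique_graphs G. is_tree Gc"
    using that clique_graph_run_acyclic_imp_chordal fin
    by (auto simp: clique_graphs_def is_tree_def)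
  show "chordal G \<longrightarrow>
      (\<forall>Gc \<in> clique_graphs G. \<forall>C. is_leaf Gc C \<longrightarrow> non_public_part G C \<noteq> {})"
    using inv leaf_non_public_part by blast
  assume "chordal G"
  then obtain Cs where Cs: "distinct Cs" "set Cs = {K. max_clique G K}" "running_intersection Cs"
    using chordal_running_intersection assms(1) by blast
  then obtain H T where run: "clique_graph_run G H T" "verts T = set Cs" "\<nexists>c. is_cycle T c"
    using running_intersection_imp_acyclic_run[OF fin Cs(3,1) _ ne] by auto
  have "H = G"
    using run_with_all_max_cliques_complete[OF assms(1) clique_graph_run_invariant[OF run(1) fin]]
      run(2) Cs(2) by simp
  with run have T: "T \<in> clique_graphs G" by (simp add: clique_graphs_def)
  have nonempty: "X \<noteq> {}" "X \<subseteq> verts G" if "X \<in> verts T" for X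
    using that run(2) Cs(2) max_clique_nonempty[OF ne] max_cliqueD(1)[of G X] by simp_all
  have "(A, B) \<in> {(X, Y). {X, Y} \<in> edges T}\<^sup>*" if AB: "A \<in> verts T" "B \<in> verts T" for A B
  proof -
    \<comment> \<open>Nodes are nonempty, so a walk in the connected graph \<open>G\<close> between
      representatives lifts to \<open>T\<close>.\<close>
    obtain x y where xy: "x \<in> A" "y \<in> B" using AB[THEN nonempty(1)] by blast
    then have "x \<in> verts G" "y \<in> verts G" using AB[THEN nonempty(2)] by blast+
    then have "(x, y) \<in> {(a, b). {a, b} \<in> edges G}\<^sup>*"
      using assms(2) by (simp add: connected_graph_def)
    then show ?thesis using run_invariant_connected[OF inv[OF T]] AB xy by blast
  qed
  moreover have "verts T \<noteq> {}"
    using inv[OF T] ne by (auto simp: run_invariant_def)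
  ultimately have "is_tree T" using run(3) by (simp add: is_tree_def connected_graph_def)
  with T show "\<exists>Gc \<in> clique_graphs G. is_tree Gc" by blast
qed

end
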